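(* Suppose that $(X,T)$ is a minimal dynamical system. Given $A\in C(X,GL(d,\mathbb{R}))$, either there is $c\in \mathbb{R}$ such that $\chi(x)=c$ for any $x\in X$, or $A\in\mathcal{R}_d$.
   Context: $(X,d)$ is a compact metric space and $T:X\to X$ is continuous; $(X,T)$ is called a dynamical system. $C(X,GL(d,\mathbb{R}))$ is the space of continuous maps from $X$ into the invertible $d\times d$ real matrices; $A_n(x)=A(T^{n-1}x)\cdots A(Tx)A(x)$; $\chi(x)=\lim_{n\to\infty}\frac1n\log\|A_n(x)\|$ when the limit exists ("$\chi(x)=c$" means that the limit exists and equals $c$). $LI_A$ is the set of $x\in X$ for which $\lim_{n\to\infty}\frac1n\log\|A_n(x)\|$ diverges, and $\mathcal{R}_d=\{A\in C(X,GL(d,\mathbb{R}))\mid LI_A\text{ is residual in }X\}$, where residual means containing a dense $G_\delta$ subset. *)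

theory Defs
  imports "HOL-Analysis.Analysis"
begin

definition dynamical_system :: "'a::metric_space set \<Rightarrow> ('a \<Rightarrow> 'a) \<Rightarrow> bool" where
  "dynamical_system X T \<longleftrightarrow> compact X \<and> continuous_on X T \<and> T \<in> X \<rightarrow> X"

definition minimal_system :: "'a::metric_space set \<Rightarrow> ('a \<Rightarrow> 'a) \<Rightarrow> bool" where
  "minimal_system X T \<longleftrightarrow>
     dynamical_system X T \<and>
     (\<forall>Y. Y \<subseteq> X \<and> closed Y \<and> Y \<noteq> {} \<and> T ` Y \<subseteq> Y \<longrightarrow> Y = X)"

text \<open>Only the values on \<open>X\<close> matter. The topology on matrices is the product topology,
  and the index type \<open>'n\<close> plays the role of the dimension.\<close>

definition C_GL :: "'a::metric_space set \<Rightarrow> ('a \<Rightarrow> real^'n^'n) set" where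
  "C_GL X = {A. continuous_on X A \<and> (\<forall>x\<in>X. invertible (A x))}"

primrec cocycle :: "('a \<Rightarrow> 'a) \<Rightarrow> ('a \<Rightarrow> real^'n^'n) \<Rightarrow> nat \<Rightarrow> 'a \<Rightarrow> real^'n^'n" where
  "cocycle T A 0 x = mat 1"
| "cocycle T A (Suc n) x = A ((T ^^ n) x) ** cocycle T A n x"

text \<open>The norm is the Euclidean operator norm; the library's \<open>norm\<close> on matrices is the
  Frobenius norm.\<close>

definition growth_rate :: "('a \<Rightarrow> 'a) \<Rightarrow> ('a \<Rightarrow> real^'n^'n) \<Rightarrow> 'a \<Rightarrow> nat \<Rightarrow> real" where
  "growth_rate T A x n = 1 / real n * ln (onorm ((*v) (cocycle T A n x)))"

definition has_lyapunov_exponent ::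
    "('a \<Rightarrow> 'a) \<Rightarrow> ('a \<Rightarrow> real^'n^'n) \<Rightarrow> 'a \<Rightarrow> real \<Rightarrow> bool" where
  "has_lyapunov_exponent T A x c \<longleftrightarrow> growth_rate T A x \<longlonglongrightarrow> c"

definition LI :: "'a set \<Rightarrow> ('a \<Rightarrow> 'a) \<Rightarrow> ('a \<Rightarrow> real^'n^'n) \<Rightarrow> 'a set" where
  "LI X T A = {x \<in> X. \<not> convergent (growth_rate T A x)}"

definition residual_in :: "'a topology \<Rightarrow> 'a set \<Rightarrow> bool" where
  "residual_in U S \<longleftrightarrow>
     S \<subseteq> topspace U \<and> (\<exists>G. gdelta_in U G \<and> U closure_of G = topspace U \<and> G \<subseteq> S)"

definition R_set :: "'a::metric_space set \<Rightarrow> ('a \<Rightarrow> 'a) \<Rightarrow> ('a \<Rightarrow> real^'n^'n) set" where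
  "R_set X T = {A \<in> C_GL X. residual_in (top_of_set X) (LI X T A)}"

end

theory Submission
  imports Defs
begin

text \<open>
  The theorem follows from a Baire category argument applied to the functions
  \<open>f n x = 1 / n * ln (onorm (A\<^sub>n x))\<close>, which rests on three of
  their features. Each \<open>f n\<close> is continuous on \<open>X\<close>; for fixed \<open>x\<close> the sequence \<open>f n x\<close> is bounded; and \<open>f n (T x) - f n x\<close> tends to \<open>0\<close>, so that all
  points of a forward orbit have the same upper and lower limits. The last two hold because, by
  compactness, the matrices \<open>A x\<close> stretch every vector by a factor between two positive constants.

  Suppose that the upper limit at some \<open>x\<close> is larger than the lower limit at some \<open>y\<close>, and choose
  \<open>a' < b'\<close> strictly between the two. For each \<open>N\<close> the set of points at which some \<open>f n\<close> with
  \<open>n \<ge> N\<close> exceeds \<open>b'\<close> is open and contains the forward orbit of \<open>x\<close>, which is dense by minimality;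
  likewise, the set where some such \<open>f n\<close> is below \<open>a'\<close> is open and dense. The intersection of all
  these sets is a dense \<open>G\<^sub>\<delta>\<close>, and \<open>f n z\<close> diverges at each of its points \<open>z\<close>.

  Otherwise every upper limit is at most every lower limit, so all of them coincide, and the
  common value, finite by boundedness, is the limit at every point. The lemma
  \<open>minimal_convergence_dichotomy\<close> carries out this argument.
\<close>

section \<open>Residual sets in minimal systems\<close>

lemma residual_in_mono:
  assumes "residual_in U S" "S \<subseteq> S'" "S' \<subseteq> topspace U"
  shows "residual_in U S'"
  using assms unfolding residual_in_def by blast

lemma residual_in_Inter_open_dense:
  assumes U: "completely_metrizable_space U"
    and G: "countable \<G>" "\<G> \<noteq> {}"
    and od: "\<And>S. S \<in> \<G> \<Longrightarrow> openin U S \<and> U closure_of S = topspace U"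
  shows "residual_in U (\<Inter>\<G>)"
proof -
  obtain M d where M: "Metric_space M d" "Metric_space.mcomplete M d"
    "U = Metric_space.mtopology M d"
    using U unfolding completely_metrizable_space_def by blast
  have "U closure_of \<Inter>\<G> = topspace U"
    using Metric_space.metric_Baire_category[OF M(1,2) G(1)] od
    by (simp add: M(3) Metric_space.topspace_mtopology[OF M(1)])
  moreover have "gdelta_in U (\<Inter>\<G>)"
    using G od by (intro gdelta_in_Inter open_imp_gdelta_in) auto
  ultimately show ?thesis
    unfolding residual_in_def using gdelta_in_subset by blast
qed

text \<open>The closure of a forward orbit is a nonempty closed set that \<open>T\<close> maps into itself.\<close>

lemma minimal_orbit_dense:
  assumes "minimal_system X T" "x \<in> X"
  shows "closure (range (\<lambda>k. (T ^^ k) x)) = X"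
proof -
  define Orb where "Orb = range (\<lambda>k. (T ^^ k) x)"
  have X: "compact X" "continuous_on X T" "T \<in> X \<rightarrow> X"
    and min: "\<And>Y. Y \<subseteq> X \<Longrightarrow> closed Y \<Longrightarrow> Y \<noteq> {} \<Longrightarrow> T ` Y \<subseteq> Y \<Longrightarrow> Y = X"
    using assms(1) by (auto simp: minimal_system_def dynamical_system_def)
  have "(T ^^ k) x \<in> X" for k
    using assms(2) X(3) by (induction k) auto
  then have sub: "closure Orb \<subseteq> X"
    using compact_imp_closed[OF X(1)] unfolding Orb_def by (intro closure_minimal) auto
  have "T ` Orb \<subseteq> Orb"
    unfolding Orb_def by (auto intro: range_eqI[where x = "Suc _"])
  then have "T ` closure Orb \<subseteq> closure Orb"
    using continuous_image_closure_subset[OF X(2) sub] closure_mono by blast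
  then have "closure Orb = X"
    using sub by (intro min) (auto simp: Orb_def)
  then show ?thesis
    by (simp add: Orb_def)
qed

lemma iterate_asymptotically_invariant:
  fixes f :: "nat \<Rightarrow> 'a \<Rightarrow> real"
  assumes T: "T \<in> X \<rightarrow> X"
    and inv: "\<And>x. x \<in> X \<Longrightarrow> (\<lambda>n. f n (T x) - f n x) \<longlonglongrightarrow> 0"
    and x: "x \<in> X"
  shows "(\<lambda>n. f n ((T ^^ k) x) - f n x) \<longlonglongrightarrow> 0"
proof (induction k)
  case (Suc k)
  have "(T ^^ k) x \<in> X"
    using x T by (induction k) auto
  from tendsto_add[OF inv[OF this] Suc.IH] show ?case
    by simp
qed simp

text \<open>The loss from \<open>b\<close> to \<open>b'\<close> absorbs the error term \<open>f n (T\<^sup>k x) - f n x\<close>: the condition then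
  passes from \<open>x\<close> to its whole forward orbit.\<close>

lemma open_dense_exceeding:
  fixes f :: "nat \<Rightarrow> 'a::metric_space \<Rightarrow> real" and N :: nat
  assumes min: "minimal_system X T"
    and cont: "\<And>n. continuous_on X (f n)"
    and inv: "\<And>x. x \<in> X \<Longrightarrow> (\<lambda>n. f n (T x) - f n x) \<longlonglongrightarrow> 0"
    and x: "x \<in> X" and freq: "\<exists>\<^sub>F n in sequentially. b < f n x" and b': "b' < b"
  defines "S \<equiv> {y \<in> X. \<exists>n\<ge>N. b' < f n y}"
  shows "openin (top_of_set X) S \<and> top_of_set X closure_of S = topspace (top_of_set X)"
proof
  have "S = (\<Union>n\<in>{N..}. X \<inter> f n -` {b'<..})"
    by (auto simp: S_def)
  then show "openin (top_of_set X) S"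
    using continuous_openin_preimage_gen[OF cont open_greaterThan]
    by (simp only:) (rule openin_Union, elim imageE, hypsubst)
next
  have T: "T \<in> X \<rightarrow> X"
    using min by (auto simp: minimal_system_def dynamical_system_def)
  have "(T ^^ k) x \<in> S" for k
  proof -
    have "\<forall>\<^sub>F n in sequentially. b' - b < f n ((T ^^ k) x) - f n x"
      using iterate_asymptotically_invariant[where f = f, OF T inv x] b' by (intro order_tendstoD) auto
    with freq have "\<exists>\<^sub>F n in sequentially. b < f n x \<and> b' - b < f n ((T ^^ k) x) - f n x"
      by (rule frequently_eventually_frequently)
    then obtain n where "n \<ge> N" "b < f n x" "b' - b < f n ((T ^^ k) x) - f n x"
      unfolding frequently_sequentially by blast
    moreover have "(T ^^ k) x \<in> X"
      using x T by (induction k) auto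
    ultimately show ?thesis
      by (auto simp: S_def intro!: exI[of _ n])
  qed
  then have "X \<subseteq> closure S"
    using closure_mono[of "range (\<lambda>k. (T ^^ k) x)" S] minimal_orbit_dense[OF min x] by auto
  moreover have "X \<inter> S = S"
    by (auto simp: S_def)
  ultimately show "top_of_set X closure_of S = topspace (top_of_set X)"
    by (auto simp: closure_of_subtopology)
qed

theorem minimal_convergence_dichotomy:
  fixes f :: "nat \<Rightarrow> 'a::metric_space \<Rightarrow> real"
  assumes min: "minimal_system X T"
    and cont: "\<And>n. continuous_on X (f n)"
    and inv: "\<And>x. x \<in> X \<Longrightarrow> (\<lambda>n. f n (T x) - f n x) \<longlonglongrightarrow> 0"
    and bdd: "\<And>x. x \<in> X \<Longrightarrow> bounded (range (\<lambda>n. f n x))"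
  shows "(\<exists>c. \<forall>x\<in>X. (\<lambda>n. f n x) \<longlonglongrightarrow> c) \<or>
    residual_in (top_of_set X) {x \<in> X. \<not> convergent (\<lambda>n. f n x)}"
proof (cases "\<exists>x\<in>X. \<exists>y\<in>X. \<exists>a b. a < b \<and> (\<exists>\<^sub>F n in sequentially. b < f n x)
    \<and> (\<exists>\<^sub>F n in sequentially. f n y < a)")
  case True
  then obtain x y a b where xy: "x \<in> X" "y \<in> X" and "a < b"
    and x: "\<exists>\<^sub>F n in sequentially. b < f n x" and y: "\<exists>\<^sub>F n in sequentially. f n y < a"
    by blast
  obtain a' where a': "a < a'" "a' < b" using dense[OF \<open>a < b\<close>] by blast
  obtain b' where b': "a' < b'" "b' < b" using dense[OF a'(2)] by blast
  define U where "U N = {z \<in> X. \<exists>n\<ge>N. b' < f n z}" for N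
  (* V N is the set where some f n with n >= N is below a', written for the functions - f n so
     that open_dense_exceeding covers it too. *)
  define V where "V N = {z \<in> X. \<exists>n\<ge>N. - a' < - f n z}" for N
  have U: "openin (top_of_set X) (U N) \<and> top_of_set X closure_of (U N) = topspace (top_of_set X)"
    for N
    unfolding U_def using min cont inv xy(1) x b'(2) by (rule open_dense_exceeding)
  have inv': "(\<lambda>n. - f n (T z) - - f n z) \<longlonglongrightarrow> 0" if "z \<in> X" for z
    using tendsto_minus[OF inv[OF that]] by simp
  have V: "openin (top_of_set X) (V N) \<and> top_of_set X closure_of (V N) = topspace (top_of_set X)"
    for N
    unfolding V_def
    using a'(1) y
    by (intro open_dense_exceeding[where f = "\<lambda>n z. - f n z" and b = "- a", OF min _ inv' xy(2)]
        continuous_on_minus cont) auto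
  have "compact_space (top_of_set X)"
    using min by (simp add: minimal_system_def dynamical_system_def compact_space_subtopology)
  then have "completely_metrizable_space (top_of_set X)"
    by (intro locally_compact_imp_completely_metrizable_space metrizable_space_subtopology
        metrizable_space_euclidean compact_imp_locally_compact_space)
  then have "residual_in (top_of_set X) (\<Inter>(range U \<union> range V))"
    by (rule residual_in_Inter_open_dense) (use U V in auto)
  moreover have "\<Inter>(range U \<union> range V) \<subseteq> {z \<in> X. \<not> convergent (\<lambda>n. f n z)}"
  proof
    fix z assume "z \<in> \<Inter>(range U \<union> range V)"
    then have "z \<in> U N" "z \<in> V N" for N by auto
    then have z: "z \<in> X" and above: "\<exists>\<^sub>F n in sequentially. b' < f n z"
      and below: "\<exists>\<^sub>F n in sequentially. f n z < a'"
      by (auto simp: U_def V_def frequently_sequentially)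
    have False if "(\<lambda>n. f n z) \<longlonglongrightarrow> l" for l
    proof (cases "l < b'")
      case True
      then have "\<forall>\<^sub>F n in sequentially. \<not> b' < f n z"
        by (intro eventually_mono[OF order_tendstoD(2)[OF that]]) auto
      with above show False by (simp add: frequently_def)
    next
      case False
      then have "a' < l" using b' by simp
      then have "\<forall>\<^sub>F n in sequentially. \<not> f n z < a'"
        by (intro eventually_mono[OF order_tendstoD(1)[OF that]]) auto
      with below show False by (simp add: frequently_def)
    qed
    with z show "z \<in> {z \<in> X. \<not> convergent (\<lambda>n. f n z)}"
      by (auto simp: convergent_def)
  qed
  ultimately show ?thesis
    by (auto intro: residual_in_mono)
next
  case False
  then have sep: "\<And>x y a b. \<lbrakk>x \<in> X; y \<in> X; a < b; \<exists>\<^sub>F n in sequentially. b < f n x;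
      \<exists>\<^sub>F n in sequentially. f n y < a\<rbrakk> \<Longrightarrow> False"
    by blast
  show ?thesis
  proof (cases "X = {}")
    case False
    then obtain x0 where x0: "x0 \<in> X" by blast
    (* A cluster value c at x0 is at least the lower limit at x0, hence at least every upper
       limit; likewise it is at most every lower limit. So it is the limit at every point. *)
    obtain c r where r: "strict_mono (r :: nat \<Rightarrow> nat)" and c: "(\<lambda>n. f (r n) x0) \<longlonglongrightarrow> c"
      using bounded_imp_convergent_subsequence[OF bdd[OF x0]] by (auto simp: o_def)
    have near: "\<exists>\<^sub>F n in sequentially. c - e < f n x0 \<and> f n x0 < c + e" if "e > 0" for e
    proof -
      have "\<forall>\<^sub>F n in sequentially. c - e < f (r n) x0 \<and> f (r n) x0 < c + e"
        using that by (intro eventually_conj order_tendstoD[OF c]) auto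
      then obtain K where K: "\<And>n. n \<ge> K \<Longrightarrow> c - e < f (r n) x0 \<and> f (r n) x0 < c + e"
        unfolding eventually_sequentially by blast
      show ?thesis
        unfolding frequently_sequentially
      proof
        fix N
        have "r (max N K) \<ge> N"
          using seq_suble[OF r, of "max N K"] by linarith
        then show "\<exists>n\<ge>N. c - e < f n x0 \<and> f n x0 < c + e"
          using K[of "max N K"] by auto
      qed
    qed
    have "(\<lambda>n. f n x) \<longlonglongrightarrow> c" if x: "x \<in> X" for x
    proof (rule order_tendstoI)
      fix l assume "l < c"
      define e where "e = (c - l) / 3"
      have e: "e > 0" "l = c - 3 * e" using \<open>l < c\<close> by (simp_all add: e_def diff_divide_distrib)
      have "\<not> (\<exists>\<^sub>F n in sequentially. f n x < c - 2 * e)"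
        using sep[OF x0 x, of "c - 2 * e" "c - e"] frequently_elim1[OF near[OF e(1)]] e(1)
        by force
      then show "\<forall>\<^sub>F n in sequentially. l < f n x"
        unfolding not_frequently by (rule eventually_mono) (use e in auto)
    next
      fix u assume "c < u"
      define e where "e = (u - c) / 3"
      have e: "e > 0" "u = c + 3 * e" using \<open>c < u\<close> by (simp_all add: e_def diff_divide_distrib)
      have "\<not> (\<exists>\<^sub>F n in sequentially. c + 2 * e < f n x)"
        using sep[OF x x0, of "c + e" "c + 2 * e"] frequently_elim1[OF near[OF e(1)]] e(1)
        by force
      then show "\<forall>\<^sub>F n in sequentially. f n x < u"
        unfolding not_frequently by (rule eventually_mono) (use e in auto)
    qed
    then show ?thesis by blast
  qed simp
qed

section \<open>Operator norms of matrix products\<close>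

lemma onorm_matrix_diff_le:
  fixes M N :: "real^'n^'m"
  shows "\<bar>onorm ((*v) M) - onorm ((*v) N)\<bar> \<le> onorm ((*v) (M - N))"
proof -
  have le: "onorm ((*v) P) \<le> onorm ((*v) (P - Q)) + onorm ((*v) Q)" for P Q :: "real^'n^'m"
    using onorm_triangle[OF matrix_vector_mul_bounded_linear[of "P - Q"]
        matrix_vector_mul_bounded_linear[of Q]]
    by (simp add: algebra_simps)
  have "(*v) (N - M) = (\<lambda>v. - ((M - N) *v v))"
    by (auto simp: algebra_simps)
  then have "onorm ((*v) (N - M)) = onorm ((*v) (M - N))"
    by (simp add: onorm_neg)
  with le[of M N] le[of N M] show ?thesis by linarith
qed

lemma continuous_on_onorm_matrix:
  fixes F :: "'a::topological_space \<Rightarrow> real^'n^'m"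
  assumes "continuous_on X F"
  shows "continuous_on X (\<lambda>x. onorm ((*v) (F x)))"
  unfolding continuous_on_def
proof
  fix x assume "x \<in> X"
  then have F: "(F \<longlongrightarrow> F x) (at x within X)"
    using assms by (simp add: continuous_on_def)
  have "((\<lambda>y. \<Sum>i\<in>UNIV. \<Sum>j\<in>UNIV. \<bar>(F y - F x) $ i $ j\<bar>) \<longlongrightarrow>
      (\<Sum>i\<in>UNIV. \<Sum>j\<in>UNIV. \<bar>(F x - F x) $ i $ j\<bar>)) (at x within X)"
    by (intro tendsto_intros F)
  then have *: "((\<lambda>y. \<Sum>i\<in>UNIV. \<Sum>j\<in>UNIV. \<bar>(F y - F x) $ i $ j\<bar>) \<longlongrightarrow> 0) (at x within X)"
    by simp
  have "norm (onorm ((*v) (F y)) - onorm ((*v) (F x)))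
      \<le> (\<Sum>i\<in>UNIV. \<Sum>j\<in>UNIV. \<bar>(F y - F x) $ i $ j\<bar>)" for y
    using onorm_matrix_diff_le onorm_le_matrix_component_sum
    unfolding real_norm_def by (rule order_trans)
  then have "((\<lambda>y. onorm ((*v) (F y)) - onorm ((*v) (F x))) \<longlongrightarrow> 0) (at x within X)"
    by (intro Lim_null_comparison[OF _ *] always_eventually allI)
  then show "((\<lambda>y. onorm ((*v) (F y))) \<longlongrightarrow> onorm ((*v) (F x))) (at x within X)"
    by (simp add: LIM_zero_iff)
qed

lemma continuous_on_matrix_mult:
  fixes F :: "'a::topological_space \<Rightarrow> real^'n^'m" and G :: "'a \<Rightarrow> real^'p^'n"
  assumes "continuous_on X F" "continuous_on X G"
  shows "continuous_on X (\<lambda>x. F x ** G x)"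
  unfolding matrix_matrix_mult_def
  by (intro continuous_intros assms)

text \<open>For an invertible \<open>B\<close> these are the bounds \<open>K \<ge> \<parallel>B\<parallel>\<close> and \<open>m \<le> 1 / \<parallel>B\<^sup>-\<^sup>1\<parallel>\<close>, phrased so that
  compactness yields them without continuity of the inverse.\<close>

definition stretch_bounds :: "real \<Rightarrow> real \<Rightarrow> real^'n^'n \<Rightarrow> bool" where
  "stretch_bounds m K B \<longleftrightarrow> (\<forall>v. m * norm v \<le> norm (B *v v) \<and> norm (B *v v) \<le> K * norm v)"

lemma stretch_bounds_onorm:
  assumes "stretch_bounds m K B"
  shows "m \<le> onorm ((*v) B)" "onorm ((*v) B) \<le> K"
proof -
  show "onorm ((*v) B) \<le> K"
    using assms by (intro onorm_le) (auto simp: stretch_bounds_def)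
  obtain v :: "real^'a" where v: "norm v = 1"
    using vector_choose_size[of 1] by auto
  have "m * norm v \<le> onorm ((*v) B) * norm v"
    using assms onorm[OF matrix_vector_mul_bounded_linear, of B v]
    by (auto simp: stretch_bounds_def intro: order_trans)
  with v show "m \<le> onorm ((*v) B)" by simp
qed

lemma onorm_mult_left_bounds:
  fixes B P :: "real^'n^'n"
  assumes B: "stretch_bounds m K B" and m: "0 < m"
  shows "m * onorm ((*v) P) \<le> onorm ((*v) (B ** P))" "onorm ((*v) (B ** P)) \<le> K * onorm ((*v) P)"
proof -
  have "norm (P *v v) \<le> onorm ((*v) (B ** P)) / m * norm v" for v
  proof -
    have "m * norm (P *v v) \<le> norm ((B ** P) *v v)"
      using B by (simp add: stretch_bounds_def flip: matrix_vector_mul_assoc)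
    also have "\<dots> \<le> onorm ((*v) (B ** P)) * norm v"
      by (rule onorm) simp
    finally show ?thesis using m by (simp add: field_simps)
  qed
  then have "onorm ((*v) P) \<le> onorm ((*v) (B ** P)) / m"
    by (rule onorm_le)
  then show "m * onorm ((*v) P) \<le> onorm ((*v) (B ** P))"
    using m by (simp add: field_simps)
  have K: "0 \<le> K"
    using stretch_bounds_onorm[OF B] m by linarith
  have "norm ((B ** P) *v v) \<le> K * onorm ((*v) P) * norm v" for v
  proof -
    have "norm ((B ** P) *v v) \<le> K * norm (P *v v)"
      using B by (simp add: stretch_bounds_def flip: matrix_vector_mul_assoc)
    also have "\<dots> \<le> K * (onorm ((*v) P) * norm v)"
      by (intro mult_left_mono onorm K) simp
    finally show ?thesis by simp
  qed
  then show "onorm ((*v) (B ** P)) \<le> K * onorm ((*v) P)"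
    by (rule onorm_le)
qed

text \<open>The lower bound holds because every vector is of the form \<open>B *v v\<close>.\<close>

lemma onorm_mult_right_bounds:
  fixes B P :: "real^'n^'n"
  assumes B: "stretch_bounds m K B" and m: "0 < m" and inv: "invertible B"
  shows "m * onorm ((*v) P) \<le> onorm ((*v) (P ** B))" "onorm ((*v) (P ** B)) \<le> K * onorm ((*v) P)"
proof -
  have "norm (P *v w) \<le> onorm ((*v) (P ** B)) / m * norm w" for w
  proof -
    obtain B' where "B ** B' = mat 1"
      using inv by (auto simp: invertible_def)
    then have w: "w = B *v (B' *v w)"
      by (simp add: matrix_vector_mul_assoc)
    define v where "v = B' *v w"
    have "norm (P *v w) = norm ((P ** B) *v v)"
      using w by (simp add: v_def flip: matrix_vector_mul_assoc)
    also have "\<dots> \<le> onorm ((*v) (P ** B)) * norm v"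
      by (rule onorm) simp
    also have "norm v \<le> norm w / m"
      using B m w by (metis stretch_bounds_def v_def mult.commute pos_le_divide_eq)
    finally show ?thesis
      by (simp add: mult_left_mono onorm_pos_le)
  qed
  then have "onorm ((*v) P) \<le> onorm ((*v) (P ** B)) / m"
    by (rule onorm_le)
  then show "m * onorm ((*v) P) \<le> onorm ((*v) (P ** B))"
    using m by (simp add: field_simps)
  have "norm ((P ** B) *v v) \<le> K * onorm ((*v) P) * norm v" for v
  proof -
    have "norm ((P ** B) *v v) \<le> onorm ((*v) P) * norm (B *v v)"
      using onorm[OF matrix_vector_mul_bounded_linear, of P "B *v v"]
      by (simp flip: matrix_vector_mul_assoc)
    also have "\<dots> \<le> onorm ((*v) P) * (K * norm v)"
      using B by (intro mult_left_mono onorm_pos_le) (auto simp: stretch_bounds_def)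
    finally show ?thesis by (simp add: mult_ac)
  qed
  then show "onorm ((*v) (P ** B)) \<le> K * onorm ((*v) P)"
    by (rule onorm_le)
qed

text \<open>The function \<open>(x, v) \<mapsto> norm (A x *v v)\<close> is continuous and positive on the compact product of
  \<open>X\<close> with the unit sphere; \<open>m\<close> and \<open>K\<close> are its extreme values.\<close>

lemma compact_stretch_bounds:
  fixes A :: "'a::metric_space \<Rightarrow> real^'n^'n"
  assumes X: "compact X" "X \<noteq> {}" and A: "A \<in> C_GL X"
  obtains m K where "0 < m" "\<And>x. x \<in> X \<Longrightarrow> stretch_bounds m K (A x)"
proof -
  define g where "g p = norm (A (fst p) *v snd p)" for p :: "'a \<times> (real^'n)"
  define Z where "Z = X \<times> sphere (0 :: real^'n) 1"
  have inv: "invertible (A x)" if "x \<in> X" for x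
    using A that by (auto simp: C_GL_def)
  have "continuous_on Z (\<lambda>p. A (fst p))"
    using A continuous_on_compose2[OF _ continuous_on_fst[OF continuous_on_id], of X A Z]
    by (auto simp: Z_def C_GL_def)
  then have g: "continuous_on Z g"
    unfolding g_def matrix_vector_mult_def by (intro continuous_intros)
  have Z: "compact Z" "Z \<noteq> {}"
    using X by (auto simp: Z_def intro!: compact_Times)
  obtain p where p: "p \<in> Z" "\<And>q. q \<in> Z \<Longrightarrow> g p \<le> g q"
    using continuous_attains_inf[OF Z g] by blast
  obtain q where q: "q \<in> Z" "\<And>r. r \<in> Z \<Longrightarrow> g r \<le> g q"
    using continuous_attains_sup[OF Z g] by blast
  have "A (fst p) *v snd p \<noteq> 0"
    using p(1) inv[of "fst p"] unfolding Z_def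
    by (metis invertible_def matrix_left_invertible_ker mem_Times_iff mem_sphere_0 norm_zero
        zero_neq_one)
  then have "0 < g p" by (simp add: g_def)
  moreover have "stretch_bounds (g p) (g q) (A x)" if x: "x \<in> X" for x
    unfolding stretch_bounds_def
  proof
    fix v
    show "g p * norm v \<le> norm (A x *v v) \<and> norm (A x *v v) \<le> g q * norm v"
    proof (cases "v = 0")
      case False
      define u where "u = v /\<^sub>R norm v"
      have "(x, u) \<in> Z" using x False by (simp add: Z_def u_def)
      then have "g p \<le> g (x, u)" "g (x, u) \<le> g q" using p q by auto
      moreover have "g (x, u) = norm (A x *v v) / norm v"
        by (simp add: g_def u_def matrix_vector_mult_scaleR divide_inverse mult.commute)
      ultimately show ?thesis using False by (simp add: field_simps)
    qed simp
  qed
  ultimately show ?thesis by (rule that)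
qed

section \<open>Growth rates of cocycles\<close>

lemma cocycle_shift: "cocycle T A (Suc n) x = cocycle T A n (T x) ** A x"
proof (induction n)
  case (Suc n)
  have "cocycle T A (Suc (Suc n)) x = A ((T ^^ Suc n) x) ** (cocycle T A n (T x) ** A x)"
    using Suc by simp
  also have "(T ^^ Suc n) x = (T ^^ n) (T x)"
    by (simp add: funpow_swap1)
  finally show ?case
    by (simp add: matrix_mul_assoc)
qed simp

lemma continuous_on_cocycle:
  assumes T: "continuous_on X T" "T \<in> X \<rightarrow> X" and A: "continuous_on X A"
  shows "continuous_on X (cocycle T A n)"
proof (induction n)
  case (Suc n)
  have iter: "continuous_on X (T ^^ k) \<and> T ^^ k \<in> X \<rightarrow> X" for k
  proof (induction k)
    case (Suc k)
    then show ?case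
      using T continuous_on_compose2[OF T(1), of X "T ^^ k"] by (auto simp: o_def)
  qed (auto simp: id_def)
  show ?case
    using iter[of n] Suc.IH
    by (auto intro!: continuous_on_matrix_mult continuous_on_compose2[OF A, of X "T ^^ n"])
qed simp

locale bounded_cocycle =
  fixes X :: "'a set" and T :: "'a \<Rightarrow> 'a" and A :: "'a \<Rightarrow> real^'n^'n" and m K :: real
  assumes maps: "T \<in> X \<rightarrow> X"
    and m_pos: "0 < m"
    and bounds: "\<And>x. x \<in> X \<Longrightarrow> stretch_bounds m K (A x)"
    and invertible_A: "\<And>x. x \<in> X \<Longrightarrow> invertible (A x)"
begin

lemma iterate_in: "x \<in> X \<Longrightarrow> (T ^^ n) x \<in> X"
  using maps by (induction n) auto

lemma K_pos: "x \<in> X \<Longrightarrow> 0 < K"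
  using stretch_bounds_onorm[OF bounds] m_pos by force

lemma onorm_cocycle_bounds:
  assumes x: "x \<in> X"
  shows "m ^ n \<le> onorm ((*v) (cocycle T A n x))" "onorm ((*v) (cocycle T A n x)) \<le> K ^ n"
proof (induction n)
  case 0
  have "(*v) (mat 1 :: real^'n^'n) = (\<lambda>v. v)" by auto
  then show "m ^ 0 \<le> onorm ((*v) (cocycle T A 0 x))" "onorm ((*v) (cocycle T A 0 x)) \<le> K ^ 0"
    by (simp_all add: onorm_id)
next
  case (Suc n)
  note step = onorm_mult_left_bounds[OF bounds[OF iterate_in[OF x, of n]] m_pos,
      of "cocycle T A n x"]
  have "m * m ^ n \<le> m * onorm ((*v) (cocycle T A n x))"
    using Suc(1) m_pos by simp
  with step show "m ^ Suc n \<le> onorm ((*v) (cocycle T A (Suc n) x))" by simp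
  have "K * onorm ((*v) (cocycle T A n x)) \<le> K * K ^ n"
    using Suc(2) K_pos[OF x] by simp
  with step show "onorm ((*v) (cocycle T A (Suc n) x)) \<le> K ^ Suc n" by simp
qed

lemma onorm_cocycle_pos: "x \<in> X \<Longrightarrow> 0 < onorm ((*v) (cocycle T A n x))"
  using onorm_cocycle_bounds(1)[of x n] m_pos by (metis less_le_trans zero_less_power)

lemma bounded_growth_rate:
  assumes x: "x \<in> X"
  shows "bounded (range (growth_rate T A x))"
proof -
  have "growth_rate T A x n \<in> {min 0 (ln m)..max 0 (ln K)}" for n
  proof (cases "n = 0")
    case False
    have "ln (m ^ n) \<le> ln (onorm ((*v) (cocycle T A n x)))"
      "ln (onorm ((*v) (cocycle T A n x))) \<le> ln (K ^ n)"
      using onorm_cocycle_bounds[OF x, of n] onorm_cocycle_pos[OF x, of n] m_pos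
      by (auto intro!: ln_mono)
    then have "ln m \<le> growth_rate T A x n" "growth_rate T A x n \<le> ln K"
      using False m_pos K_pos[OF x]
      by (simp_all add: growth_rate_def ln_realpow field_simps)
    then show ?thesis by auto
  qed (simp add: growth_rate_def)
  then have "range (growth_rate T A x) \<subseteq> {min 0 (ln m)..max 0 (ln K)}" by blast
  then show ?thesis
    using bounded_closed_interval bounded_subset by blast
qed

text \<open>\<open>A\<^sub>n\<^sub>+\<^sub>1 x\<close> arises from \<open>A\<^sub>n x\<close> by a factor on the left and from \<open>A\<^sub>n (T x)\<close> by a factor on
  the right, so the logarithms of the two norms differ by at most \<open>ln K - ln m\<close>, for every \<open>n\<close>.\<close>

lemma growth_rate_asymptotically_invariant:
  assumes x: "x \<in> X"
  shows "(\<lambda>n. growth_rate T A (T x) n - growth_rate T A x n) \<longlonglongrightarrow> 0"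
proof -
  have Tx: "T x \<in> X" using maps x by auto
  have "\<bar>growth_rate T A (T x) n - growth_rate T A x n\<bar> \<le> (ln K - ln m) * (1 / real n)" for n
  proof -
    define p where "p = onorm ((*v) (cocycle T A n x))"
    define q where "q = onorm ((*v) (cocycle T A n (T x)))"
    define s where "s = onorm ((*v) (cocycle T A (Suc n) x))"
    have pos: "0 < p" "0 < q" "0 < s" "0 < m" "0 < K"
      using onorm_cocycle_pos x Tx m_pos K_pos
      by (auto simp: p_def q_def s_def simp del: cocycle.simps)
    have "m * p \<le> s" "s \<le> K * p"
      using onorm_mult_left_bounds[OF bounds[OF iterate_in[OF x, of n]] m_pos, of "cocycle T A n x"]
      by (simp_all add: p_def s_def)
    moreover have "m * q \<le> s" "s \<le> K * q"
      using onorm_mult_right_bounds[OF bounds[OF x] m_pos invertible_A[OF x],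
          of "cocycle T A n (T x)"]
      by (simp_all add: q_def s_def cocycle_shift del: cocycle.simps)
    ultimately have "m * p \<le> K * q" "m * q \<le> K * p"
      by linarith+
    then have "ln (m * p) \<le> ln (K * q)" "ln (m * q) \<le> ln (K * p)"
      using pos by (auto intro!: ln_mono)
    then have "\<bar>ln q - ln p\<bar> \<le> ln K - ln m"
      using pos by (simp add: ln_mult)
    then have "\<bar>ln q - ln p\<bar> * (1 / real n) \<le> (ln K - ln m) * (1 / real n)"
      by (intro mult_right_mono) auto
    then show ?thesis
      by (simp add: growth_rate_def p_def q_def abs_divide flip: diff_divide_distrib)
  qed
  moreover have "(\<lambda>n. (ln K - ln m) * (1 / real n)) \<longlonglongrightarrow> 0"
    by (rule tendsto_mult_right_zero[OF lim_1_over_n])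
  ultimately show ?thesis
    unfolding real_norm_def[symmetric] by (rule Lim_null_comparison[OF always_eventually[OF allI]])
qed

end

section \<open>The dichotomy for Lyapunov exponents\<close>

theorem corollary1p2:
  fixes X :: "'a::metric_space set"
    and T :: "'a \<Rightarrow> 'a"
    and A :: "'a \<Rightarrow> real^'n^'n"
  assumes "minimal_system X T"
    and "A \<in> C_GL X"
  shows "(\<exists>c::real. \<forall>x\<in>X. has_lyapunov_exponent T A x c) \<or> A \<in> R_set X T"
proof (cases "X = {}")
  case False
  have X: "compact X" "continuous_on X T" "T \<in> X \<rightarrow> X"
    using assms(1) by (auto simp: minimal_system_def dynamical_system_def)
  obtain m K where mK: "0 < m" "\<And>x. x \<in> X \<Longrightarrow> stretch_bounds m K (A x)"
    using compact_stretch_bounds[OF X(1) False assms(2)] by blast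
  interpret bounded_cocycle X T A m K
    using X mK assms(2) by unfold_locales (auto simp: C_GL_def)
  have "continuous_on X (\<lambda>x. growth_rate T A x n)" for n
  proof -
    have "continuous_on X (cocycle T A n)"
      using X assms(2) by (intro continuous_on_cocycle) (auto simp: C_GL_def)
    then have "continuous_on X (\<lambda>x. ln (onorm ((*v) (cocycle T A n x))))"
      using onorm_cocycle_pos
      by (intro continuous_on_ln continuous_on_onorm_matrix) (auto simp: less_le)
    then show ?thesis
      unfolding growth_rate_def by (intro continuous_on_mult_left)
  qed
  from minimal_convergence_dichotomy[where f = "\<lambda>n x. growth_rate T A x n", OF assms(1) this
      growth_rate_asymptotically_invariant bounded_growth_rate]
  show ?thesis
    using assms(2) by (auto simp: has_lyapunov_exponent_def R_set_def LI_def)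
qed simp

end
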